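(* Let $X$ and $Y$ be complex infinite-dimensional Banach spaces, $A\in B(X)$, $B\in B(Y)$, $C\in B(Y,X)$, and let $M_C=\begin{pmatrix}A&C\\0&B\end{pmatrix}\in B(X\oplus Y)$. Then $$\sigma_D(M_C)\cup\bigl(S(A^* )\cap S(B)\bigr)=\sigma_D(A)\cup\sigma_D(B).$$
   Context: $B(Y,X)$ is the set of bounded linear operators from $Y$ to $X$, and $B(X)=B(X,X)$. $A^*\in B(X^* )$ is the dual (Banach space adjoint) operator of $A$. An operator $T\in B(X)$ is Drazin invertible if there is $T^D\in B(X)$ with $TT^D=T^DT$, $T^DTT^D=T^D$ and $T^{k+1}T^D=T^k$ for some nonnegative integer $k$. The Drazin spectrum is $\sigma_D(T)=\{\lambda\in\mathbb{C}: T-\lambda I\text{ is not Drazin invertible}\}$ (possibly empty). $T$ has the single valued extension property (SVEP) at $\lambda\in\mathbb{C}$ if there is $r>0$ such that for every open subset $V$ of the open disc $D(\lambda,r)$, the function $f\equiv 0$ is the only analytic solution of $(T-\mu)f(\mu)=0$ for all $\mu\in V$. $S(T)=\{\lambda\in\mathbb{C}: T\text{ fails to have the SVEP at }\lambda\}$. *)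

theory Defs
  imports "HOL-Analysis.Analysis"
begin

section \<open>Complex normed spaces and complex Banach spaces\<close>

text \<open>The real structure (norm, topology, real scalars) is the library's; \<open>scaleC\<close> adds a complex
  scalar multiplication extending the real one.\<close>

class scaleC =
  fixes scaleC :: "complex \<Rightarrow> 'a \<Rightarrow> 'a"  (infixr \<open>*\<^sub>C\<close> 75)

class complex_normed_vector = scaleC + real_normed_vector +
  assumes scaleC_add_right: "c *\<^sub>C (x + y) = c *\<^sub>C x + c *\<^sub>C y"
    and scaleC_add_left: "(c + d) *\<^sub>C x = c *\<^sub>C x + d *\<^sub>C x"
    and scaleC_scaleC: "c *\<^sub>C (d *\<^sub>C x) = (c * d) *\<^sub>C x"
    and scaleC_one: "1 *\<^sub>C x = x"
    and scaleR_scaleC: "r *\<^sub>R x = complex_of_real r *\<^sub>C x"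
    and norm_scaleC: "norm (c *\<^sub>C x) = cmod c * norm x"

class cbanach = complex_normed_vector + complete_space

instance cbanach \<subseteq> banach ..

lemma vector_space_scaleC: "vector_space (scaleC :: complex \<Rightarrow> 'a \<Rightarrow> 'a::complex_normed_vector)"
  by unfold_locales
    (simp_all add: scaleC_add_right scaleC_add_left scaleC_scaleC scaleC_one)

definition cinfinite_dimensional :: "'a::complex_normed_vector itself \<Rightarrow> bool" where
  "cinfinite_dimensional _ \<longleftrightarrow>
     \<not> (\<exists>F::'a set. finite F \<and> module.span scaleC F = UNIV)"

instantiation complex :: cbanach
begin

definition scaleC_complex_def: "c *\<^sub>C (z::complex) = c * z"

instance
  by standard (simp_all add: scaleC_complex_def algebra_simps scaleR_conv_of_real norm_mult)

end

text \<open>The direct sum of two spaces is the product type, with the library norm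
  \<open>sqrt ((norm x)\<^sup>2 + (norm y)\<^sup>2)\<close>.\<close>

instantiation prod :: (complex_normed_vector, complex_normed_vector) complex_normed_vector
begin

definition scaleC_prod_def: "c *\<^sub>C p = (c *\<^sub>C fst p, c *\<^sub>C snd p)"

instance
proof
  fix c d :: complex and x y :: "'a \<times> 'b" and r :: real
  show "norm (c *\<^sub>C x) = cmod c * norm x"
  proof -
    have "norm (c *\<^sub>C x) = sqrt ((cmod c)\<^sup>2 * ((norm (fst x))\<^sup>2 + (norm (snd x))\<^sup>2))"
      by (simp add: scaleC_prod_def norm_prod_def norm_scaleC power_mult_distrib distrib_left)
    then show ?thesis
      by (simp add: real_sqrt_mult norm_prod_def)
  qed
qed (simp_all add: scaleC_prod_def scaleC_add_right scaleC_add_left scaleC_scaleC scaleC_one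
       scaleR_scaleC scaleR_prod_def)

end

instance prod :: (cbanach, cbanach) cbanach ..


section \<open>The space of bounded complex-linear operators\<close>

definition bounded_clinear :: "('a::complex_normed_vector \<Rightarrow> 'b::complex_normed_vector) \<Rightarrow> bool" where
  "bounded_clinear f \<longleftrightarrow>
     (\<forall>x y. f (x + y) = f x + f y) \<and> (\<forall>c x. f (c *\<^sub>C x) = c *\<^sub>C f x) \<and>
     (\<exists>K. \<forall>x. norm (f x) \<le> norm x * K)"

lemma bounded_clinear_iff:
  "bounded_clinear f \<longleftrightarrow> bounded_linear f \<and> (\<forall>c x. f (c *\<^sub>C x) = c *\<^sub>C f x)"
proof
  assume "bounded_clinear f"
  then show "bounded_linear f \<and> (\<forall>c x. f (c *\<^sub>C x) = c *\<^sub>C f x)"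
    by (auto simp: bounded_clinear_def scaleR_scaleC bounded_linear_def bounded_linear_axioms_def
        intro!: linearI)
next
  assume f: "bounded_linear f \<and> (\<forall>c x. f (c *\<^sub>C x) = c *\<^sub>C f x)"
  then interpret bounded_linear f by simp
  from f bounded show "bounded_clinear f"
    by (auto simp: bounded_clinear_def add)
qed

lemma bounded_clinear_imp_bounded_linear: "bounded_clinear f \<Longrightarrow> bounded_linear f"
  by (simp add: bounded_clinear_iff)

lemma scaleC_zero_right [simp]: "c *\<^sub>C (0::'a::complex_normed_vector) = 0"
  using norm_scaleC[of c "0::'a"] by simp

lemma scaleC_minus_right: "c *\<^sub>C (- x) = - (c *\<^sub>C (x::'a::complex_normed_vector))"
  using scaleC_add_right[of c x "- x"] by (simp add: eq_neg_iff_add_eq_0 add.commute)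

lemma scaleC_diff_right: "c *\<^sub>C (x - y) = c *\<^sub>C x - c *\<^sub>C (y::'a::complex_normed_vector)"
  using scaleC_add_right[of c x "- y"] by (simp add: scaleC_minus_right)

lemma bounded_linear_scaleC: "bounded_linear (\<lambda>x::'a::complex_normed_vector. c *\<^sub>C x)"
  by (rule bounded_linear_intro[where K = "cmod c"])
    (simp_all add: scaleC_add_right scaleR_scaleC scaleC_scaleC norm_scaleC mult.commute)

lemma bounded_clinear_zero: "bounded_clinear (\<lambda>x. 0)"
  by (simp add: bounded_clinear_iff bounded_linear_zero)

lemma bounded_clinear_ident: "bounded_clinear (\<lambda>x. x)"
  by (simp add: bounded_clinear_iff bounded_linear_ident)

lemma bounded_clinear_add:
  "bounded_clinear f \<Longrightarrow> bounded_clinear g \<Longrightarrow> bounded_clinear (\<lambda>x. f x + g x)"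
  by (simp add: bounded_clinear_iff bounded_linear_add scaleC_add_right)

lemma bounded_clinear_diff:
  "bounded_clinear f \<Longrightarrow> bounded_clinear g \<Longrightarrow> bounded_clinear (\<lambda>x. f x - g x)"
  by (simp add: bounded_clinear_iff bounded_linear_sub scaleC_diff_right)

lemma bounded_clinear_minus: "bounded_clinear f \<Longrightarrow> bounded_clinear (\<lambda>x. - f x)"
  by (simp add: bounded_clinear_iff bounded_linear_minus scaleC_minus_right)

lemma bounded_clinear_scaleC: "bounded_clinear f \<Longrightarrow> bounded_clinear (\<lambda>x. c *\<^sub>C f x)"
  using bounded_linear_compose[OF bounded_linear_scaleC, of f c]
  by (simp add: bounded_clinear_iff scaleC_scaleC mult.commute)

lemma bounded_clinear_scaleR: "bounded_clinear f \<Longrightarrow> bounded_clinear (\<lambda>x. r *\<^sub>R f x)"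
  by (simp add: scaleR_scaleC bounded_clinear_scaleC)

lemma bounded_clinear_compose:
  "bounded_clinear f \<Longrightarrow> bounded_clinear g \<Longrightarrow> bounded_clinear (\<lambda>x. f (g x))"
  by (simp add: bounded_clinear_iff bounded_linear_compose)

typedef (overloaded) ('a, 'b) cblinfun (\<open>(_ \<Rightarrow>\<^sub>C\<^sub>L /_)\<close> [22, 21] 21) =
  "{f :: 'a::complex_normed_vector \<Rightarrow> 'b::complex_normed_vector. bounded_clinear f}"
  morphisms cblinfun_apply CBlinfun
  using bounded_clinear_zero by blast

setup_lifting type_definition_cblinfun

lemma cblinfun_eqI: "(\<And>x. cblinfun_apply f x = cblinfun_apply g x) \<Longrightarrow> f = g"
  by transfer auto

lemma bounded_clinear_cblinfun_apply: "bounded_clinear (cblinfun_apply f)"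
  using cblinfun_apply by blast

lemma cblinfun_apply_scaleC: "cblinfun_apply f (c *\<^sub>C x) = c *\<^sub>C cblinfun_apply f x"
  using bounded_clinear_cblinfun_apply[of f] by (simp add: bounded_clinear_def)

instantiation cblinfun :: (complex_normed_vector, complex_normed_vector) complex_normed_vector
begin

lift_definition zero_cblinfun :: "'a \<Rightarrow>\<^sub>C\<^sub>L 'b" is "\<lambda>x. 0"
  by (rule bounded_clinear_zero)

lift_definition plus_cblinfun :: "'a \<Rightarrow>\<^sub>C\<^sub>L 'b \<Rightarrow> 'a \<Rightarrow>\<^sub>C\<^sub>L 'b \<Rightarrow> 'a \<Rightarrow>\<^sub>C\<^sub>L 'b"
  is "\<lambda>f g x. f x + g x"
  by (rule bounded_clinear_add)

lift_definition minus_cblinfun :: "'a \<Rightarrow>\<^sub>C\<^sub>L 'b \<Rightarrow> 'a \<Rightarrow>\<^sub>C\<^sub>L 'b \<Rightarrow> 'a \<Rightarrow>\<^sub>C\<^sub>L 'b"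
  is "\<lambda>f g x. f x - g x"
  by (rule bounded_clinear_diff)

lift_definition uminus_cblinfun :: "'a \<Rightarrow>\<^sub>C\<^sub>L 'b \<Rightarrow> 'a \<Rightarrow>\<^sub>C\<^sub>L 'b" is "\<lambda>f x. - f x"
  by (rule bounded_clinear_minus)

lift_definition scaleR_cblinfun :: "real \<Rightarrow> 'a \<Rightarrow>\<^sub>C\<^sub>L 'b \<Rightarrow> 'a \<Rightarrow>\<^sub>C\<^sub>L 'b"
  is "\<lambda>r f x. r *\<^sub>R f x"
  by (rule bounded_clinear_scaleR)

lift_definition scaleC_cblinfun :: "complex \<Rightarrow> 'a \<Rightarrow>\<^sub>C\<^sub>L 'b \<Rightarrow> 'a \<Rightarrow>\<^sub>C\<^sub>L 'b"
  is "\<lambda>c f x. c *\<^sub>C f x"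
  by (rule bounded_clinear_scaleC)

lift_definition norm_cblinfun :: "'a \<Rightarrow>\<^sub>C\<^sub>L 'b \<Rightarrow> real" is onorm .

definition dist_cblinfun :: "'a \<Rightarrow>\<^sub>C\<^sub>L 'b \<Rightarrow> 'a \<Rightarrow>\<^sub>C\<^sub>L 'b \<Rightarrow> real"
  where "dist_cblinfun f g = norm (f - g)"

definition sgn_cblinfun :: "'a \<Rightarrow>\<^sub>C\<^sub>L 'b \<Rightarrow> 'a \<Rightarrow>\<^sub>C\<^sub>L 'b"
  where "sgn_cblinfun f = inverse (norm f) *\<^sub>R f"

definition uniformity_cblinfun :: "(('a \<Rightarrow>\<^sub>C\<^sub>L 'b) \<times> ('a \<Rightarrow>\<^sub>C\<^sub>L 'b)) filter"
  where "uniformity_cblinfun = (INF e\<in>{0 <..}. principal {(f, g). dist f g < e})"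

definition open_cblinfun :: "('a \<Rightarrow>\<^sub>C\<^sub>L 'b) set \<Rightarrow> bool"
  where "open_cblinfun U \<longleftrightarrow> (\<forall>f\<in>U. eventually (\<lambda>(f', g). f' = f \<longrightarrow> g \<in> U) uniformity)"

lemma norm_scaleC_cblinfun_le: "norm (c *\<^sub>C f) \<le> cmod c * norm (f :: 'a \<Rightarrow>\<^sub>C\<^sub>L 'b)"
proof transfer
  fix c :: complex and f :: "'a \<Rightarrow> 'b"
  assume f: "bounded_clinear f"
  show "onorm (\<lambda>x. c *\<^sub>C f x) \<le> cmod c * onorm f"
  proof (rule onorm_bound)
    fix x
    have "norm (c *\<^sub>C f x) = cmod c * norm (f x)"
      by (simp add: norm_scaleC)
    also have "\<dots> \<le> cmod c * (onorm f * norm x)"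
      by (intro mult_left_mono onorm bounded_clinear_imp_bounded_linear f) simp
    finally show "norm (c *\<^sub>C f x) \<le> cmod c * onorm f * norm x"
      by (simp add: mult.assoc)
  qed (simp add: onorm_pos_le bounded_clinear_imp_bounded_linear f)
qed

instance
proof
  fix f g h :: "'a \<Rightarrow>\<^sub>C\<^sub>L 'b" and r s :: real and c d :: complex and U :: "('a \<Rightarrow>\<^sub>C\<^sub>L 'b) set"
  show "f + g + h = f + (g + h)" by transfer (simp add: add.assoc)
  show "f + g = g + f" by transfer (simp add: add.commute)
  show "0 + f = f" by transfer simp
  show "- f + f = 0" by transfer simp
  show "f - g = f + - g" by transfer simp
  show "r *\<^sub>R (f + g) = r *\<^sub>R f + r *\<^sub>R g" by transfer (simp add: scaleR_add_right)
  show "(r + s) *\<^sub>R f = r *\<^sub>R f + s *\<^sub>R f" by transfer (simp add: scaleR_add_left)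
  show "r *\<^sub>R s *\<^sub>R f = (r * s) *\<^sub>R f" by transfer simp
  show "1 *\<^sub>R f = f" by transfer simp
  show "dist f g = norm (f - g)" by (rule dist_cblinfun_def)
  show "sgn f = inverse (norm f) *\<^sub>R f" by (rule sgn_cblinfun_def)
  show "uniformity = (INF e\<in>{0 <..}. principal {(f :: 'a \<Rightarrow>\<^sub>C\<^sub>L 'b, g). dist f g < e})"
    by (rule uniformity_cblinfun_def)
  show "open U = (\<forall>f\<in>U. \<forall>\<^sub>F (f', g) in uniformity. f' = f \<longrightarrow> g \<in> U)"
    by (rule open_cblinfun_def)
  show "norm f = 0 \<longleftrightarrow> f = 0"
    by transfer (auto simp: onorm_eq_0 bounded_clinear_imp_bounded_linear)
  show "norm (f + g) \<le> norm f + norm g"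
    by transfer (simp add: onorm_triangle bounded_clinear_imp_bounded_linear)
  show "norm (r *\<^sub>R f) = \<bar>r\<bar> * norm f"
    by transfer (simp add: onorm_scaleR bounded_clinear_imp_bounded_linear)
  show "c *\<^sub>C (f + g) = c *\<^sub>C f + c *\<^sub>C g" by transfer (simp add: scaleC_add_right)
  show "(c + d) *\<^sub>C f = c *\<^sub>C f + d *\<^sub>C f" by transfer (simp add: scaleC_add_left)
  show CC: "c *\<^sub>C d *\<^sub>C f = (c * d) *\<^sub>C f" for c d by transfer (simp add: scaleC_scaleC)
  show C1: "1 *\<^sub>C f = f" by transfer (simp add: scaleC_one)
  show "r *\<^sub>R f = complex_of_real r *\<^sub>C f" by transfer (simp add: scaleR_scaleC)
  show "norm (c *\<^sub>C f) = cmod c * norm f"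
  proof (cases "c = 0")
    case True
    have "norm (c *\<^sub>C f) \<ge> 0"
      by transfer
        (simp add: onorm_pos_le bounded_clinear_imp_bounded_linear bounded_clinear_scaleC)
    then show ?thesis
      using norm_scaleC_cblinfun_le[of c f] True by simp
  next
    case False
    have "norm f \<le> cmod (inverse c) * norm (c *\<^sub>C f)"
      using norm_scaleC_cblinfun_le[of "inverse c" "c *\<^sub>C f"] False by (simp add: CC C1)
    then have "cmod c * norm f \<le> norm (c *\<^sub>C f)"
      using False by (simp add: norm_divide field_simps)
    then show ?thesis
      using norm_scaleC_cblinfun_le[of c f] by simp
  qed
qed

end

lift_definition blinfun_of_cblinfun ::
  "'a::complex_normed_vector \<Rightarrow>\<^sub>C\<^sub>L 'b::complex_normed_vector \<Rightarrow> 'a \<Rightarrow>\<^sub>L 'b" is "\<lambda>f. f"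
  by (rule bounded_clinear_imp_bounded_linear)

lemma dist_blinfun_of_cblinfun:
  "dist (blinfun_of_cblinfun f) (blinfun_of_cblinfun g) = dist f g"
  unfolding dist_norm by transfer simp

instance cblinfun :: (complex_normed_vector, cbanach) cbanach
proof
  fix F :: "nat \<Rightarrow> 'a \<Rightarrow>\<^sub>C\<^sub>L 'b"
  assume "Cauchy F"
  then have "Cauchy (\<lambda>n. blinfun_of_cblinfun (F n))"
    by (simp add: Cauchy_def dist_blinfun_of_cblinfun)
  then obtain L where L: "(\<lambda>n. blinfun_of_cblinfun (F n)) \<longlonglongrightarrow> L"
    using Cauchy_convergent_iff convergent_def by blast
  have app: "blinfun_apply (blinfun_of_cblinfun f) = cblinfun_apply f" for f :: "'a \<Rightarrow>\<^sub>C\<^sub>L 'b"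
    by transfer simp
  have lim: "(\<lambda>n. cblinfun_apply (F n) x) \<longlonglongrightarrow> blinfun_apply L x" for x
    using blinfun.tendsto[OF L tendsto_const] by (simp add: app)
  have "blinfun_apply L (c *\<^sub>C x) = c *\<^sub>C blinfun_apply L x" for c x
  proof (rule LIMSEQ_unique[OF lim])
    have "(\<lambda>n. c *\<^sub>C cblinfun_apply (F n) x) \<longlonglongrightarrow> c *\<^sub>C blinfun_apply L x"
      by (rule bounded_linear.tendsto[OF bounded_linear_scaleC lim])
    then show "(\<lambda>n. cblinfun_apply (F n) (c *\<^sub>C x)) \<longlonglongrightarrow> c *\<^sub>C blinfun_apply L x"
      by (simp add: cblinfun_apply_scaleC)
  qed
  then have "bounded_clinear (blinfun_apply L)"
    by (simp add: bounded_clinear_iff blinfun.bounded_linear_right)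
  then have "blinfun_of_cblinfun (CBlinfun (blinfun_apply L)) = L"
    by (intro blinfun_eqI) (simp add: app CBlinfun_inverse)
  then have "F \<longlonglongrightarrow> CBlinfun (blinfun_apply L)"
    using L by (simp add: tendsto_iff flip: dist_blinfun_of_cblinfun)
  then show "convergent F"
    by (rule convergentI)
qed

lift_definition id_cblinfun :: "'a::complex_normed_vector \<Rightarrow>\<^sub>C\<^sub>L 'a" is "\<lambda>x. x"
  by (rule bounded_clinear_ident)

lift_definition cblinfun_compose ::
  "'b::complex_normed_vector \<Rightarrow>\<^sub>C\<^sub>L 'c::complex_normed_vector \<Rightarrow>
   'a::complex_normed_vector \<Rightarrow>\<^sub>C\<^sub>L 'b \<Rightarrow> 'a \<Rightarrow>\<^sub>C\<^sub>L 'c"  (infixl \<open>o\<^sub>C\<^sub>L\<close> 67)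
  is "\<lambda>f g x. f (g x)"
  by (rule bounded_clinear_compose)

primrec cblinfun_power :: "'a::complex_normed_vector \<Rightarrow>\<^sub>C\<^sub>L 'a \<Rightarrow> nat \<Rightarrow> 'a \<Rightarrow>\<^sub>C\<^sub>L 'a" where
  "cblinfun_power T 0 = id_cblinfun"
| "cblinfun_power T (Suc n) = T o\<^sub>C\<^sub>L cblinfun_power T n"


section \<open>Dual operators and upper triangular operator matrices\<close>

type_synonym 'a cdual = "'a \<Rightarrow>\<^sub>C\<^sub>L complex"

lemma norm_cblinfun_compose:
  "norm (f o\<^sub>C\<^sub>L g) \<le> norm f * norm g"
  by transfer
    (use onorm_compose in \<open>auto simp: o_def dest!: bounded_clinear_imp_bounded_linear\<close>)

lift_definition dual_operator ::
  "'a::complex_normed_vector \<Rightarrow>\<^sub>C\<^sub>L 'b::complex_normed_vector \<Rightarrow> 'b cdual \<Rightarrow>\<^sub>C\<^sub>L 'a cdual"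
  is "\<lambda>(T :: 'a \<Rightarrow>\<^sub>C\<^sub>L 'b) \<phi>. \<phi> o\<^sub>C\<^sub>L T"
proof -
  fix T :: "'a \<Rightarrow>\<^sub>C\<^sub>L 'b"
  have "(\<phi> + \<psi>) o\<^sub>C\<^sub>L T = (\<phi> o\<^sub>C\<^sub>L T) + (\<psi> o\<^sub>C\<^sub>L T)" for \<phi> \<psi> :: "'b cdual"
    by transfer simp
  moreover have "(c *\<^sub>C \<phi>) o\<^sub>C\<^sub>L T = c *\<^sub>C (\<phi> o\<^sub>C\<^sub>L T)" for c and \<phi> :: "'b cdual"
    by transfer simp
  moreover have "norm (\<phi> o\<^sub>C\<^sub>L T) \<le> norm \<phi> * norm T" for \<phi> :: "'b cdual"
    by (rule norm_cblinfun_compose)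
  ultimately show "bounded_clinear (\<lambda>\<phi> :: 'b cdual. \<phi> o\<^sub>C\<^sub>L T)"
    unfolding bounded_clinear_def by blast
qed

lift_definition upper_triangular_operator ::
  "'a::complex_normed_vector \<Rightarrow>\<^sub>C\<^sub>L 'a \<Rightarrow> 'b::complex_normed_vector \<Rightarrow>\<^sub>C\<^sub>L 'a \<Rightarrow> 'b \<Rightarrow>\<^sub>C\<^sub>L 'b \<Rightarrow>
   ('a \<times> 'b) \<Rightarrow>\<^sub>C\<^sub>L ('a \<times> 'b)"
  is "\<lambda>A C B p. (A (fst p) + C (snd p), B (snd p))"
  unfolding bounded_clinear_iff
  by (auto intro!: bounded_linear_Pair bounded_linear_add
      bounded_linear_compose[OF _ bounded_linear_fst]
      bounded_linear_compose[OF _ bounded_linear_snd]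
      simp: scaleC_prod_def scaleC_add_right)


section \<open>Drazin invertibility and the Drazin spectrum\<close>

definition drazin_invertible :: "'a::complex_normed_vector \<Rightarrow>\<^sub>C\<^sub>L 'a \<Rightarrow> bool" where
  "drazin_invertible T \<longleftrightarrow>
     (\<exists>S. T o\<^sub>C\<^sub>L S = S o\<^sub>C\<^sub>L T \<and> S o\<^sub>C\<^sub>L T o\<^sub>C\<^sub>L S = S \<and>
          (\<exists>k. cblinfun_power T (k + 1) o\<^sub>C\<^sub>L S = cblinfun_power T k))"

definition drazin_spectrum :: "'a::complex_normed_vector \<Rightarrow>\<^sub>C\<^sub>L 'a \<Rightarrow> complex set" where
  "drazin_spectrum T = {l. \<not> drazin_invertible (T - l *\<^sub>C id_cblinfun)}"


section \<open>The single valued extension property\<close>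

text \<open>On an open set (the only case used below) a vector-valued function is analytic iff it is
  complex differentiable at every point; compare \<open>holomorphic_on\<close> and \<open>analytic_on\<close> for
  complex-valued functions.\<close>

definition vector_holomorphic_on ::
  "(complex \<Rightarrow> 'a::complex_normed_vector) \<Rightarrow> complex set \<Rightarrow> bool" where
  "vector_holomorphic_on f V \<longleftrightarrow>
     (\<forall>z\<in>V. \<exists>f'. (f has_derivative (\<lambda>h. h *\<^sub>C f')) (at z within V))"

definition svep_at :: "'a::complex_normed_vector \<Rightarrow>\<^sub>C\<^sub>L 'a \<Rightarrow> complex \<Rightarrow> bool" where
  "svep_at T l \<longleftrightarrow>
     (\<exists>r>0. \<forall>V. open V \<and> V \<subseteq> ball l r \<longrightarrow>
        (\<forall>f. vector_holomorphic_on f V \<and>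
             (\<forall>\<mu>\<in>V. cblinfun_apply (T - \<mu> *\<^sub>C id_cblinfun) (f \<mu>) = 0) \<longrightarrow>
             (\<forall>\<mu>\<in>V. f \<mu> = 0)))"

definition svep_failure_set :: "'a::complex_normed_vector \<Rightarrow>\<^sub>C\<^sub>L 'a \<Rightarrow> complex set" where
  "svep_failure_set T = {l. \<not> svep_at T l}"

end

theory Submission
  imports Defs
begin

text \<open>After replacing \<open>A\<close> and \<open>B\<close> by \<open>A - l\<close> and \<open>B - l\<close>, the claim at the point \<open>l\<close> is an
  equivalence: \<open>A\<close> and \<open>B\<close> are both Drazin invertible iff \<open>M = upper_triangular_operator A C B\<close> is
  and moreover the dual of \<open>A\<close> or \<open>B\<close> has the SVEP at \<open>l\<close>.

  From left to right, \<open>B\<close> has the SVEP because a Drazin invertible operator has no eigenvalue close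
  to, but different from, \<open>0\<close>. That \<open>M\<close> is Drazin invertible follows from a one-sided criterion
  (\<open>drazin_invertibleI\<close>): it is enough that \<open>M ^ n = M ^ (n + 1) U\<close> for some bounded \<open>U\<close> and that
  \<open>M ^ (n + 1)\<close> has the same kernel as \<open>M ^ n\<close>. For large even \<open>n\<close> both conditions can be read off
  from \<open>A\<close> and \<open>B\<close>, by treating the two coordinates one after the other.

  From right to left, let \<open>D\<close> be a Drazin inverse of \<open>M\<close> of index \<open>k\<close>, with block entries
  \<open>D11, D12, D21, D22\<close>. If \<open>D21 = 0\<close>, then \<open>D11\<close> and \<open>D22\<close> are Drazin inverses of \<open>A\<close> and \<open>B\<close>, so
  everything rests on the vanishing of this corner. Comparing entries in
  \<open>M ^ (k + 1) D = M ^ k = D M ^ (k + 1)\<close> gives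
  \<open>B ^ k = B ^ (k + 1) D22\<close>, \<open>B ^ (k + 1) D21 = 0\<close>, \<open>A ^ k = D11 A ^ (k + 1)\<close> and
  \<open>D21 A ^ (k + 1) = 0\<close>, and \<open>D = M ^ k D ^ (k + 1) = D ^ (k + 1) M ^ k\<close> shows that \<open>D21\<close> has the
  left factor \<open>B ^ k\<close> and the right factor \<open>A ^ k\<close>.

  The SVEP enters through \<open>svep_at_imp_kernel_stable\<close>: if \<open>R ^ k = R ^ (k + 1) U\<close> and \<open>R ^ (k + 1) y = 0\<close>,
  then \<open>\<mu> \<mapsto> R ^ k (1 - \<mu> U)\<^sup>-\<^sup>1 y\<close> is an analytic solution of \<open>(R - \<mu>) f(\<mu>) = 0\<close>, whence
  \<open>R ^ k y = f(0) = 0\<close>. If \<open>B\<close> has the SVEP, this applied to \<open>B\<close> and \<open>D22\<close> cancels the powers of \<open>B\<close>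
  on the left of \<open>D21\<close>. If the dual of \<open>A\<close> has the SVEP, it is applied to the duals of \<open>A\<close> and
  \<open>D11\<close>, and cancels the powers of \<open>A\<close> on the right of \<open>\<phi> \<circ> D21\<close> for every functional \<open>\<phi>\<close>; by the
  Hahn-Banach theorem, bounded functionals separate points, so again \<open>D21 = 0\<close>.\<close>

declare [[coercion cblinfun_apply]]

notation cblinfun_power (infixr \<open>\<up>\<close> 80)

section \<open>Bounded functionals separate points\<close>

definition sublinear :: "('a::real_vector \<Rightarrow> real) \<Rightarrow> bool" where
  "sublinear p \<longleftrightarrow> (\<forall>x y. p (x + y) \<le> p x + p y) \<and> (\<forall>t\<ge>0. \<forall>x. p (t *\<^sub>R x) \<le> t * p x)"

lemma sublinear_add: "sublinear p \<Longrightarrow> p (x + y) \<le> p x + p y"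
  by (simp add: sublinear_def)

lemma sublinear_zero:
  assumes "sublinear p"
  shows "p 0 = 0"
proof -
  have "p (0 *\<^sub>R 0) \<le> 0 * p 0"
    using assms unfolding sublinear_def by blast
  moreover have "p (0 + 0) \<le> p 0 + p 0"
    by (rule sublinear_add[OF assms])
  ultimately show ?thesis by simp
qed

lemma sublinear_scaleR:
  assumes "sublinear p" "t \<ge> 0"
  shows "p (t *\<^sub>R x) = t * p x"
proof (cases "t = 0")
  case True
  then show ?thesis using sublinear_zero[OF assms(1)] by simp
next
  case False
  have "p (inverse t *\<^sub>R t *\<^sub>R x) \<le> inverse t * p (t *\<^sub>R x)"
    using assms unfolding sublinear_def by (metis inverse_nonnegative_iff_nonnegative)
  then have "t * p x \<le> p (t *\<^sub>R x)"
    using False assms(2) by (simp add: field_simps)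
  then show ?thesis
    using assms unfolding sublinear_def by (meson order_antisym)
qed

lemma sublinear_minus: "sublinear p \<Longrightarrow> - p (- x) \<le> p x"
  using sublinear_add[of p x "- x"] sublinear_zero[of p] by simp

text \<open>The largest sublinear functional \<open>q \<le> p\<close> with \<open>q (- x) = - p x\<close>. It forces linearity along the
  line through \<open>x\<close>, and serves twice: to show that minimal sublinear functionals are linear, and to
  prescribe the value of the resulting linear functional at one point.\<close>

definition tilt :: "('a::real_vector \<Rightarrow> real) \<Rightarrow> 'a \<Rightarrow> 'a \<Rightarrow> real" where
  "tilt p x y = (INF t\<in>{0..}. p (y + t *\<^sub>R x) - t * p x)"

lemma tilt_le:
  assumes "sublinear p" "t \<ge> 0"
  shows "tilt p x y \<le> p (y + t *\<^sub>R x) - t * p x"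
  unfolding tilt_def
proof (rule cINF_lower)
  show "bdd_below ((\<lambda>t. p (y + t *\<^sub>R x) - t * p x) ` {0..})"
  proof (rule bdd_belowI2)
    fix t :: real assume "t \<in> {0..}"
    then show "- p (- y) \<le> p (y + t *\<^sub>R x) - t * p x"
      using sublinear_add[OF assms(1), of "y + t *\<^sub>R x" "- y"]
        sublinear_scaleR[OF assms(1), of t x] by simp
  qed
qed (use assms in auto)

lemma le_tilt:
  assumes "\<And>t. t \<ge> 0 \<Longrightarrow> c \<le> p (y + t *\<^sub>R x) - t * p x"
  shows "c \<le> tilt p x y"
  unfolding tilt_def by (rule cINF_greatest) (use assms in auto)

lemma tilt_le_self: "sublinear p \<Longrightarrow> tilt p x y \<le> p y"
  using tilt_le[of p 0 x y] by simp

lemma tilt_minus: "sublinear p \<Longrightarrow> tilt p x (- x) \<le> - p x"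
  using tilt_le[of p 1 x "- x"] by (simp add: sublinear_zero)

lemma sublinear_tilt:
  assumes p: "sublinear p"
  shows "sublinear (tilt p x)"
  unfolding sublinear_def
proof (intro conjI allI impI)
  fix y z
  have *: "tilt p x (y + z) \<le> (p (y + t *\<^sub>R x) - t * p x) + (p (z + s *\<^sub>R x) - s * p x)"
    if "t \<ge> 0" "s \<ge> 0" for t s
  proof -
    have "tilt p x (y + z) \<le> p ((y + t *\<^sub>R x) + (z + s *\<^sub>R x)) - (t + s) * p x"
      using tilt_le[OF p, of "t + s" x "y + z"] that by (simp add: algebra_simps)
    also have "\<dots> \<le> (p (y + t *\<^sub>R x) - t * p x) + (p (z + s *\<^sub>R x) - s * p x)"
      using sublinear_add[OF p, of "y + t *\<^sub>R x" "z + s *\<^sub>R x"] by (simp add: algebra_simps)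
    finally show ?thesis .
  qed
  have "tilt p x (y + z) - (p (z + s *\<^sub>R x) - s * p x) \<le> tilt p x y" if "s \<ge> 0" for s
    by (rule le_tilt) (use *[OF _ that] in \<open>simp add: algebra_simps\<close>)
  then have "tilt p x (y + z) - tilt p x y \<le> tilt p x z"
    by (intro le_tilt) (simp add: algebra_simps)
  then show "tilt p x (y + z) \<le> tilt p x y + tilt p x z"
    by simp
next
  fix s :: real and y assume s: "s \<ge> 0"
  show "tilt p x (s *\<^sub>R y) \<le> s * tilt p x y"
  proof (cases "s = 0")
    case True
    then show ?thesis using tilt_le_self[OF p, of x 0] sublinear_zero[OF p] by simp
  next
    case False
    have "inverse s * tilt p x (s *\<^sub>R y) \<le> tilt p x y"
    proof (rule le_tilt)
      fix t :: real assume "t \<ge> 0"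
      then have "tilt p x (s *\<^sub>R y) \<le> p (s *\<^sub>R (y + t *\<^sub>R x)) - (s * t) * p x"
        using tilt_le[OF p, of "s * t" x "s *\<^sub>R y"] s by (simp add: algebra_simps)
      also have "\<dots> = s * (p (y + t *\<^sub>R x) - t * p x)"
        unfolding sublinear_scaleR[OF p s] by (simp add: algebra_simps)
      finally show "inverse s * tilt p x (s *\<^sub>R y) \<le> p (y + t *\<^sub>R x) - t * p x"
        using s False by (simp add: field_simps)
    qed
    then show ?thesis using s False by (simp add: field_simps)
  qed
qed

text \<open>Zorn's lemma applies because a chain of sublinear functionals below \<open>p0\<close> is bounded below
  pointwise by \<open>x \<mapsto> - p0 (- x)\<close>, and its pointwise infimum is again sublinear.\<close>

lemma minimal_sublinear_exists:
  assumes p0: "sublinear p0"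
  obtains m where "sublinear m" "m \<le> p0" "\<And>q. sublinear q \<Longrightarrow> q \<le> m \<Longrightarrow> q = m"
proof -
  define S where "S = {p. sublinear p \<and> p \<le> p0}"
  define P where "P = (\<lambda>p q :: 'a \<Rightarrow> real. q \<le> p)"
  have lower: "- p0 (- x) \<le> p x" if "p \<in> S" for p x
    using that sublinear_minus[of p x] le_funD[of p p0 "- x"] by (simp add: S_def)
  have "\<exists>m\<in>S. \<forall>a\<in>S. P m a \<longrightarrow> a = m"
  proof (rule predicate_Zorn)
    show "partial_order_on S (relation_of P S)"
      unfolding P_def by (rule partial_order_on_relation_ofI) auto
    fix C assume C: "C \<in> Chains (relation_of P S)"
    show "\<exists>u\<in>S. \<forall>a\<in>C. P a u"
    proof (cases "C = {}")
      case True
      then show ?thesis using p0 by (auto simp: S_def)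
    next
      case False
      have CS: "C \<subseteq> S" and tot: "\<And>p q. p \<in> C \<Longrightarrow> q \<in> C \<Longrightarrow> p \<le> q \<or> q \<le> p"
        using C by (auto simp: Chains_def relation_of_def P_def)
      define u where "u = (\<lambda>x. INF p\<in>C. p x)"
      have u_le: "u x \<le> p x" if "p \<in> C" for p x
        unfolding u_def
        by (rule cINF_lower[OF bdd_belowI2[where m = "- p0 (- x)"] that]) (use CS lower in auto)
      have le_u: "c \<le> u x" if "\<And>p. p \<in> C \<Longrightarrow> c \<le> p x" for c x
        unfolding u_def by (rule cINF_greatest) (use False that in auto)
      have "sublinear u"
        unfolding sublinear_def
      proof (intro conjI allI impI)
        fix x y
        have *: "u (x + y) \<le> p x + q y" if pq: "p \<in> C" "q \<in> C" for p q
        proof -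
          (* comparability in the chain: the smaller functional bounds both summands *)
          define r where "r = (if p \<le> q then p else q)"
          have r: "r \<in> C" "r \<le> p" "r \<le> q"
            using tot[OF pq] pq by (auto simp: r_def)
          have "u (x + y) \<le> r (x + y)" by (rule u_le[OF r(1)])
          also have "\<dots> \<le> r x + r y"
            by (rule sublinear_add) (use r(1) CS in \<open>auto simp: S_def\<close>)
          also have "\<dots> \<le> p x + q y" by (rule add_mono[OF le_funD[OF r(2)] le_funD[OF r(3)]])
          finally show ?thesis .
        qed
        have "u (x + y) - q y \<le> u x" if "q \<in> C" for q
          by (rule le_u) (use *[OF _ that] in \<open>simp add: algebra_simps\<close>)
        then have "u (x + y) - u x \<le> u y"
          by (intro le_u) (simp add: algebra_simps)
        then show "u (x + y) \<le> u x + u y" by simp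
      next
        fix t :: real and x assume t: "t \<ge> 0"
        show "u (t *\<^sub>R x) \<le> t * u x"
        proof (cases "t = 0")
          case True
          obtain p where "p \<in> C" using False by blast
          then show ?thesis using u_le[of p 0] sublinear_zero[of p] CS True
            by (auto simp: S_def)
        next
          case False
          have "inverse t * u (t *\<^sub>R x) \<le> u x"
          proof (rule le_u)
            fix p assume "p \<in> C"
            then have "u (t *\<^sub>R x) \<le> t * p x"
              using u_le[of p "t *\<^sub>R x"] sublinear_scaleR[of p t x] CS t by (auto simp: S_def)
            then show "inverse t * u (t *\<^sub>R x) \<le> p x"
              using t False by (simp add: field_simps)
          qed
          then show ?thesis using t False by (simp add: field_simps)
        qed
      qed
      moreover have "u \<le> p0"
      proof (rule le_funI)
        fix x
        obtain p where p: "p \<in> C" using False by blast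
        then have "p \<le> p0" using CS by (auto simp: S_def)
        then show "u x \<le> p0 x" using u_le[OF p, of x] le_funD[of p p0 x] by linarith
      qed
      ultimately show ?thesis
        using u_le by (intro bexI[of _ u]) (auto simp: S_def P_def le_fun_def)
    qed
  qed
  then obtain m where m: "m \<in> S" "\<And>q. q \<in> S \<Longrightarrow> q \<le> m \<Longrightarrow> q = m"
    unfolding P_def by blast
  show thesis
    by (rule that[of m]) (use m in \<open>auto simp: S_def\<close>)
qed

text \<open>Minimality gives \<open>tilt m x = m\<close> for every \<open>x\<close>, so \<open>m\<close> is odd; an odd sublinear functional is linear.\<close>

lemma minimal_sublinear_linear:
  assumes m: "sublinear m" and min: "\<And>q. sublinear q \<Longrightarrow> q \<le> m \<Longrightarrow> q = m"
  shows "linear m"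
proof -
  have odd: "m (- x) = - m x" for x
  proof -
    have "tilt m x = m"
      by (intro min sublinear_tilt m le_funI tilt_le_self)
    then show ?thesis
      using tilt_minus[OF m, of x] sublinear_minus[OF m, of x] by simp
  qed
  show ?thesis
  proof (rule linearI)
    fix x y
    have "- m (x + y) \<le> - m x - m y"
      using sublinear_add[OF m, of "- x" "- y"] odd[of "x + y"] by (simp add: odd)
    then show "m (x + y) = m x + m y"
      using sublinear_add[OF m, of x y] by simp
  next
    fix t :: real and x
    show "m (t *\<^sub>R x) = t *\<^sub>R m x"
    proof (cases "t \<ge> 0")
      case True
      then show ?thesis by (simp add: sublinear_scaleR[OF m])
    next
      case False
      then show ?thesis
        using sublinear_scaleR[OF m, of "- t" x] odd[of "t *\<^sub>R x"] by simp
    qed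
  qed
qed

text \<open>A minimal sublinear functional below \<open>tilt p x\<close> is linear and at most \<open>- p x\<close> at \<open>- x\<close>.\<close>

lemma hahn_banach_attained:
  assumes p: "sublinear p"
  obtains f where "linear f" "\<And>y. f y \<le> p y" "f x = p x"
proof -
  obtain f where f: "sublinear f" "f \<le> tilt p x" "\<And>q. sublinear q \<Longrightarrow> q \<le> f \<Longrightarrow> q = f"
    using minimal_sublinear_exists[OF sublinear_tilt[OF p]] by blast
  then have lin: "linear f" by (intro minimal_sublinear_linear)
  have le: "f y \<le> p y" for y
    using le_funD[OF f(2), of y] tilt_le_self[OF p, of x y] by simp
  have "f (- x) \<le> - p x"
    using le_funD[OF f(2), of "- x"] tilt_minus[OF p, of x] by simp
  then have "f x = p x"
    using le[of x] linear_neg[OF lin, of x] by simp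
  with lin le show thesis by (rule that)
qed

text \<open>A real linear \<open>f\<close> with \<open>f \<le> norm\<close> and \<open>f x = norm x\<close> is the real part of the complex functional
  \<open>y \<mapsto> f y - \<i> f (\<i> y)\<close>, which does not vanish at \<open>x\<close>.\<close>

lemma cdual_separates_points:
  fixes x :: "'a::complex_normed_vector"
  assumes "\<And>\<phi> :: 'a cdual. \<phi> x = 0"
  shows "x = 0"
proof (rule ccontr)
  assume "x \<noteq> 0"
  have "sublinear (norm :: 'a \<Rightarrow> real)"
    by (simp add: sublinear_def norm_triangle_ineq)
  then obtain f :: "'a \<Rightarrow> real" where f: "linear f" "\<And>y. f y \<le> norm y" "f x = norm x"
    using hahn_banach_attained[where p = norm and x = x] by blast
  have fabs: "\<bar>f y\<bar> \<le> norm y" for y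
    using f(2)[of y] f(2)[of "- y"] linear_neg[OF f(1), of y] by simp
  define g where "g y = Complex (f y) (- f (\<i> *\<^sub>C y))" for y
  have add: "f (y + z) = f y + f z" for y z by (rule linear_add[OF f(1)])
  have scale: "f (complex_of_real r *\<^sub>C y) = r * f y" for r y
    using linear_scale[OF f(1), of r y] by (simp add: scaleR_scaleC)
  have fc: "f (c *\<^sub>C y) = Re c * f y + Im c * f (\<i> *\<^sub>C y)" for c y
  proof -
    have "c *\<^sub>C y = complex_of_real (Re c) *\<^sub>C y + complex_of_real (Im c) *\<^sub>C (\<i> *\<^sub>C y)"
      unfolding scaleC_scaleC scaleC_add_left[symmetric]
      by (subst complex_eq[of c]) (simp add: mult.commute)
    then show ?thesis by (simp add: add scale)
  qed
  have "bounded_clinear g"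
    unfolding bounded_clinear_def
  proof (intro conjI allI exI)
    fix y z c
    show "g (y + z) = g y + g z"
      by (simp add: g_def add scaleC_add_right complex_eq_iff)
    show "g (c *\<^sub>C y) = c *\<^sub>C g y"
      using fc[of c y] fc[of "\<i> * c" y]
      by (simp add: g_def scaleC_complex_def complex_eq_iff scaleC_scaleC)
    have "norm (g y) \<le> \<bar>f y\<bar> + \<bar>f (\<i> *\<^sub>C y)\<bar>"
      using cmod_le[of "g y"] by (simp add: g_def)
    also have "\<dots> \<le> norm y * 2"
      using fabs[of y] fabs[of "\<i> *\<^sub>C y"] by (simp add: norm_scaleC)
    finally show "norm (g y) \<le> norm y * 2" .
  qed
  then have "cblinfun_apply (CBlinfun g) = g"
    by (simp add: CBlinfun_inverse)
  then have "g x = 0" using assms[of "CBlinfun g"] by simp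
  then have "f x = 0" by (simp add: g_def complex_eq_iff)
  with f(3) \<open>x \<noteq> 0\<close> show False by simp
qed


section \<open>Evaluation of operators\<close>

lemma scaleC_zero_left: "0 *\<^sub>C (x::'a::complex_normed_vector) = 0"
  using norm_scaleC[of 0 x] by simp

lemma cblinfun_add [simp]:
  fixes T :: "'a::complex_normed_vector \<Rightarrow>\<^sub>C\<^sub>L 'b::complex_normed_vector"
  shows "T (x + y) = T x + T y"
  using bounded_clinear_cblinfun_apply[of T] by (simp add: bounded_clinear_def)

lemma bounded_linear_cblinfun: "bounded_linear (cblinfun_apply T)"
  by (rule bounded_clinear_imp_bounded_linear[OF bounded_clinear_cblinfun_apply])

lemma cblinfun_zero [simp]:
  fixes T :: "'a::complex_normed_vector \<Rightarrow>\<^sub>C\<^sub>L 'b::complex_normed_vector"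
  shows "T 0 = 0"
  using cblinfun_add[of T 0 0] by simp

lemma cblinfun_diff:
  fixes T :: "'a::complex_normed_vector \<Rightarrow>\<^sub>C\<^sub>L 'b::complex_normed_vector"
  shows "T (x - y) = T x - T y"
  by (rule linear_diff[OF bounded_linear.linear[OF bounded_linear_cblinfun]])

lemma norm_cblinfun:
  fixes T :: "'a::complex_normed_vector \<Rightarrow>\<^sub>C\<^sub>L 'b::complex_normed_vector"
  shows "norm (T x) \<le> norm T * norm x"
  by transfer (simp add: onorm bounded_clinear_imp_bounded_linear)

lemma id_cblinfun_apply [simp]: "id_cblinfun x = x"
  by transfer simp

lemma cblinfun_compose_apply [simp]: "(S o\<^sub>C\<^sub>L T) x = S (T x)"
  by transfer simp

lemma zero_cblinfun_apply [simp]: "cblinfun_apply 0 x = 0"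
  by transfer simp

lemma minus_cblinfun_apply [simp]:
  fixes S T :: "'a::complex_normed_vector \<Rightarrow>\<^sub>C\<^sub>L 'b::complex_normed_vector"
  shows "(S - T) x = S x - T x"
  by transfer simp

lemma scaleC_cblinfun_apply [simp]:
  fixes T :: "'a::complex_normed_vector \<Rightarrow>\<^sub>C\<^sub>L 'b::complex_normed_vector"
  shows "(c *\<^sub>C T) x = c *\<^sub>C T x"
  by transfer simp

lemma dual_operator_apply [simp]: "dual_operator T \<phi> = \<phi> o\<^sub>C\<^sub>L T"
  by transfer simp

lemma upper_triangular_operator_apply [simp]:
  "upper_triangular_operator A C B p = (A (fst p) + C (snd p), B (snd p))"
  by transfer simp

lemma CBlinfun_apply: "bounded_clinear f \<Longrightarrow> cblinfun_apply (CBlinfun f) = f"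
  by (simp add: CBlinfun_inverse)

lemma bounded_clinear_fst: "bounded_clinear f \<Longrightarrow> bounded_clinear (\<lambda>x. fst (f x))"
  unfolding bounded_clinear_iff
  using bounded_linear_compose[OF bounded_linear_fst] by (auto simp: scaleC_prod_def)

lemma bounded_clinear_snd: "bounded_clinear f \<Longrightarrow> bounded_clinear (\<lambda>x. snd (f x))"
  unfolding bounded_clinear_iff
  using bounded_linear_compose[OF bounded_linear_snd] by (auto simp: scaleC_prod_def)

lemma bounded_clinear_Pair:
  "bounded_clinear f \<Longrightarrow> bounded_clinear g \<Longrightarrow> bounded_clinear (\<lambda>x. (f x, g x))"
  unfolding bounded_clinear_iff by (auto simp: scaleC_prod_def intro: bounded_linear_Pair)

lemmas bounded_clinear_intros =
  bounded_clinear_fst bounded_clinear_snd bounded_clinear_Pair bounded_clinear_zero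
  bounded_clinear_ident bounded_clinear_add bounded_clinear_diff
  bounded_clinear_compose[OF bounded_clinear_cblinfun_apply]

lemma cblinfun_power_add: "(T \<up> (m + n)) x = (T \<up> m) ((T \<up> n) x)"
  by (induction m) auto

lemma cblinfun_power_Suc_right: "(T \<up> Suc n) x = (T \<up> n) (T x)"
  using cblinfun_power_add[of T n 1 x] by simp

lemma dual_operator_power: "(dual_operator T \<up> n) \<phi> = \<phi> o\<^sub>C\<^sub>L (T \<up> n)"
proof (induction n)
  case (Suc n)
  show ?case
    unfolding cblinfun_power.simps(2)[of "dual_operator T"]
    by (rule cblinfun_eqI) (simp add: Suc cblinfun_power_Suc_right del: cblinfun_power.simps)
qed (auto intro: cblinfun_eqI)

lemma dual_operator_shift:
  "dual_operator (T - l *\<^sub>C id_cblinfun) = dual_operator T - l *\<^sub>C id_cblinfun"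
  by (intro cblinfun_eqI) (simp add: cblinfun_diff cblinfun_apply_scaleC)

lemma upper_triangular_operator_shift:
  "upper_triangular_operator (A - l *\<^sub>C id_cblinfun) C (B - l *\<^sub>C id_cblinfun)
     = upper_triangular_operator A C B - l *\<^sub>C id_cblinfun"
  by (intro cblinfun_eqI) (simp add: scaleC_prod_def)

lemma upper_triangular_power_fst:
  "(upper_triangular_operator A C B \<up> n) (x, 0) = ((A \<up> n) x, 0)"
  by (induction n) auto

lemma upper_triangular_power_snd:
  "snd ((upper_triangular_operator A C B \<up> n) p) = (B \<up> n) (snd p)"
  by (induction n) auto


section \<open>Drazin inverses\<close>

definition drazin_inverse :: "'a::complex_normed_vector \<Rightarrow>\<^sub>C\<^sub>L 'a \<Rightarrow> 'a \<Rightarrow>\<^sub>C\<^sub>L 'a \<Rightarrow> nat \<Rightarrow> bool" where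
  "drazin_inverse T S k \<longleftrightarrow>
     (\<forall>x. T (S x) = S (T x)) \<and> (\<forall>x. S (T (S x)) = S x) \<and> (\<forall>x. (T \<up> (k + 1)) (S x) = (T \<up> k) x)"

lemma drazin_invertible_iff: "drazin_invertible T \<longleftrightarrow> (\<exists>S k. drazin_inverse T S k)"
proof -
  have eq: "F = G \<longleftrightarrow> (\<forall>x. F x = G x)" for F G :: "'a \<Rightarrow>\<^sub>C\<^sub>L 'a"
    by (auto intro: cblinfun_eqI)
  show ?thesis
    unfolding drazin_invertible_def drazin_inverse_def eq cblinfun_compose_apply by blast
qed

lemma drazin_inverse_commute_power:
  assumes "drazin_inverse T S k"
  shows "(T \<up> n) (S x) = S ((T \<up> n) x)"
  using assms by (induction n) (auto simp: drazin_inverse_def)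

lemma drazin_inverse_power:
  "drazin_inverse T S k \<Longrightarrow> (T \<up> (k + 1)) (S x) = (T \<up> k) x"
  unfolding drazin_inverse_def by blast

lemma drazin_inverse_kernel_stable:
  assumes "drazin_inverse T S k" "(T \<up> (k + 1)) x = 0"
  shows "(T \<up> k) x = 0"
  using drazin_inverse_power[OF assms(1), of x] drazin_inverse_commute_power[OF assms(1), of "k + 1" x]
  by (simp only: assms(2) cblinfun_zero)

lemma drazin_inverse_square:
  assumes "drazin_inverse T S k"
  shows "T (S (S x)) = S x" "S (S (T x)) = S x"
  using assms unfolding drazin_inverse_def by metis+

lemma drazin_inverse_mono:
  assumes "drazin_inverse T S k" "k \<le> n"
  shows "drazin_inverse T S n"
proof -
  have "(T \<up> (n + 1)) (S x) = (T \<up> n) x" for x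
    using assms(2) cblinfun_power_add[of T "n - k" "k + 1" "S x"] cblinfun_power_add[of T "n - k" k x]
    by (simp add: drazin_inverse_power[OF assms(1), simplified])
  with assms(1) show ?thesis unfolding drazin_inverse_def by blast
qed

text \<open>Iterating \<open>S = T S S\<close>.\<close>

lemma drazin_inverse_factor_left:
  assumes "drazin_inverse T S k"
  shows "S x = (T \<up> n) ((S \<up> (n + 1)) x)"
proof (induction n)
  case (Suc n)
  have "(T \<up> Suc n) ((S \<up> (Suc n + 1)) x) = (T \<up> n) (T (S (S ((S \<up> n) x))))"
    by (simp only: cblinfun_power_Suc_right[of T]) simp
  also have "\<dots> = (T \<up> n) ((S \<up> (n + 1)) x)"
    by (simp only: drazin_inverse_square(1)[OF assms]) simp
  finally show ?case using Suc by simp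
qed simp

lemma drazin_inverse_factor_right:
  assumes "drazin_inverse T S k"
  shows "S x = (S \<up> (n + 1)) ((T \<up> n) x)"
proof (induction n arbitrary: x)
  case (Suc n)
  have "(S \<up> (Suc n + 1)) ((T \<up> Suc n) x) = S ((S \<up> (n + 1)) ((T \<up> n) (T x)))"
    by (simp only: cblinfun_power_Suc_right[of T n x]) simp
  also have "\<dots> = S (S (T x))" by (simp only: Suc[of "T x", symmetric])
  also have "\<dots> = S x" by (rule drazin_inverse_square(2)[OF assms])
  finally show ?case by simp
qed simp

text \<open>One right factorisation of \<open>T ^ k\<close> through a higher power yields one through every higher power,
  although \<open>U\<close> need not commute with \<open>T\<close>.\<close>

lemma power_right_factor:
  assumes "\<And>x. (T \<up> k) x = (T \<up> (k + 1)) ((U :: 'a::complex_normed_vector \<Rightarrow>\<^sub>C\<^sub>L 'a) x)"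
  shows "(T \<up> (k + n)) ((U \<up> n) x) = (T \<up> k) x"
proof (induction n)
  case (Suc n)
  have "(T \<up> (k + Suc n)) ((U \<up> Suc n) x) = (T \<up> n) ((T \<up> (k + 1)) (U ((U \<up> n) x)))"
    using cblinfun_power_add[of T n "k + 1"] by (simp add: add.commute)
  also have "\<dots> = (T \<up> (k + n)) ((U \<up> n) x)"
    by (simp only: assms[symmetric]) (simp only: cblinfun_power_add[symmetric] add.commute)
  finally show ?case using Suc by simp
qed simp

lemma power_kernel_stable:
  assumes "\<And>x. (T \<up> (k + 1)) x = 0 \<Longrightarrow> (T \<up> k) x = 0" and "(T \<up> (k + n)) x = 0"
  shows "(T \<up> k) x = 0"
  using assms(2)
proof (induction n)
  case (Suc n)
  have "(T \<up> (k + 1)) ((T \<up> n) x) = 0"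
    using Suc.prems cblinfun_power_add[of T "k + 1" n x] by simp
  then have "(T \<up> k) ((T \<up> n) x) = 0" by (rule assms(1))
  then have "(T \<up> (k + n)) x = 0" by (simp only: cblinfun_power_add)
  then show ?case by (rule Suc.IH)
qed simp

text \<open>The Drazin inverse is \<open>S = T ^ k U ^ (k + 1)\<close>. Since \<open>T ^ (k + 1) S = T ^ k\<close>, the operators
  \<open>T S - S T\<close> and \<open>S - T S S\<close> are annihilated by \<open>T ^ (k + 1)\<close>. Both factor through \<open>T ^ k\<close> on the
  left, and on the range of \<open>T ^ k\<close> the operator \<open>T ^ (k + 1)\<close> is injective by the kernel condition.\<close>

lemma drazin_invertibleI:
  fixes T U :: "'a::complex_normed_vector \<Rightarrow>\<^sub>C\<^sub>L 'a"
  assumes U: "\<And>x. (T \<up> k) x = (T \<up> (k + 1)) (U x)"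
    and ker: "\<And>x. (T \<up> (k + 1)) x = 0 \<Longrightarrow> (T \<up> k) x = 0"
  shows "drazin_invertible T"
proof -
  define S where "S = (T \<up> k) o\<^sub>C\<^sub>L (U \<up> (k + 1))"
  have S: "S x = (T \<up> k) ((U \<up> (k + 1)) x)" for x
    by (simp add: S_def)
  have TS: "(T \<up> (k + 1)) (S x) = (T \<up> k) x" for x
    using power_right_factor[OF U, of "k + 1" x]
    by (simp only: S cblinfun_power_add[symmetric] add.commute)
  have cancel: "(T \<up> k) z = 0" if "(T \<up> (k + 1)) ((T \<up> k) z) = 0" for z
  proof (rule power_kernel_stable[of T k "k + 1"])
    show "(T \<up> (k + (k + 1))) z = 0"
      using that by (simp only: cblinfun_power_add[symmetric] ac_simps)
  qed (rule ker)
  have swap: "T ((T \<up> n) x) = (T \<up> n) (T x)" for n x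
    using cblinfun_power_Suc_right[of T n x] by simp
  have comm: "T (S x) = S (T x)" for x
  proof -
    define z where "z = T ((U \<up> (k + 1)) x) - (U \<up> (k + 1)) (T x)"
    have z: "(T \<up> k) z = T (S x) - S (T x)"
      by (simp only: z_def cblinfun_diff S swap)
    have "(T \<up> (k + 1)) ((T \<up> k) z) = T ((T \<up> (k + 1)) (S x)) - (T \<up> (k + 1)) (S (T x))"
      by (simp only: z cblinfun_diff swap)
    also have "\<dots> = 0" by (simp only: TS swap) simp
    finally show ?thesis using cancel[of z] z by simp
  qed
  have idem: "S (T (S x)) = S x" for x
  proof -
    define y where "y = S x"
    define z where "z = (U \<up> (k + 1)) x - T ((U \<up> (k + 1)) y)"
    have "(T \<up> k) z = S x - T (S y)"
      by (simp only: z_def cblinfun_diff S swap)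
    then have z: "(T \<up> k) z = S x - T (S (S x))" by (simp only: y_def)
    have "(T \<up> (k + 1)) ((T \<up> k) z) = (T \<up> (k + 1)) (S x) - T ((T \<up> (k + 1)) (S (S x)))"
      by (simp only: z cblinfun_diff swap)
    also have "\<dots> = (T \<up> k) x - T ((T \<up> k) (S x))" by (simp only: TS)
    also have "\<dots> = 0" using TS[of x] by simp
    finally show ?thesis using cancel[of z] z comm[of "S x"] by simp
  qed
  show ?thesis
    unfolding drazin_invertible_iff drazin_inverse_def using comm idem TS by blast
qed


section \<open>Drazin invertibility and the single valued extension property\<close>

text \<open>With \<open>R = T - l\<close> and Drazin inverse \<open>S\<close>, an eigenvector \<open>R x = \<nu> x\<close> with \<open>\<nu> \<noteq> 0\<close> satisfies
  \<open>x = \<nu> S x\<close>, which is impossible for \<open>\<bar>\<nu>\<bar> \<parallel>S\<parallel> < 1\<close>. So near \<open>l\<close> a solution of \<open>(T - \<mu>) f \<mu> = 0\<close>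
  vanishes off \<open>l\<close>, and at \<open>l\<close> by continuity.\<close>

lemma drazin_invertible_imp_svep_at:
  fixes T :: "'a::complex_normed_vector \<Rightarrow>\<^sub>C\<^sub>L 'a"
  assumes "drazin_invertible (T - l *\<^sub>C id_cblinfun)"
  shows "svep_at T l"
proof -
  define R where "R = T - l *\<^sub>C id_cblinfun"
  obtain S k where D: "drazin_inverse R S k"
    using assms unfolding drazin_invertible_iff R_def by blast
  define r where "r = inverse (norm S + 1)"
  have r: "r > 0" by (simp add: r_def add_nonneg_pos)
  have inj: "x = 0" if x: "(T - \<mu> *\<^sub>C id_cblinfun) x = 0" and \<mu>: "\<mu> \<in> ball l r" "\<mu> \<noteq> l" for x \<mu>
  proof -
    define \<nu> where "\<nu> = \<mu> - l"
    have \<nu>: "\<nu> \<noteq> 0" "cmod \<nu> < r"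
      using \<mu> by (auto simp: \<nu>_def dist_norm norm_minus_commute)
    have "R x = \<nu> *\<^sub>C x"
      using x scaleC_add_left[of "\<mu> - l" l x] by (simp add: R_def \<nu>_def algebra_simps)
    then have pow: "(R \<up> n) x = \<nu> ^ n *\<^sub>C x" for n
      by (induction n) (simp_all add: scaleC_one cblinfun_apply_scaleC scaleC_scaleC mult.commute)
    have "\<nu> ^ k *\<^sub>C x = \<nu> ^ (k + 1) *\<^sub>C S x"
      using drazin_inverse_power[OF D, of x] drazin_inverse_commute_power[OF D, of "k + 1" x]
      by (simp only: pow cblinfun_apply_scaleC)
    then have "inverse (\<nu> ^ k) *\<^sub>C \<nu> ^ k *\<^sub>C x = inverse (\<nu> ^ k) *\<^sub>C \<nu> ^ (k + 1) *\<^sub>C S x" by simp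
    moreover have "inverse (\<nu> ^ k) * \<nu> ^ (k + 1) = \<nu>" "inverse (\<nu> ^ k) * \<nu> ^ k = 1"
      using \<nu>(1) by simp_all
    ultimately have "x = \<nu> *\<^sub>C S x"
      by (simp only: scaleC_scaleC scaleC_one)
    then have "norm x \<le> cmod \<nu> * (norm S * norm x)"
      using norm_cblinfun[of S x] by (metis norm_scaleC mult_left_mono norm_ge_zero)
    moreover have "cmod \<nu> * norm S < 1"
    proof -
      have "cmod \<nu> * norm S \<le> cmod \<nu> * (norm S + 1)" by (simp add: mult_left_mono)
      also have "\<dots> < r * (norm S + 1)" using \<nu>(2) by (intro mult_strict_right_mono) (auto simp: add_nonneg_pos)
      also have "\<dots> = 1" unfolding r_def using norm_ge_zero[of S] by (intro left_inverse) linarith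
      finally show ?thesis .
    qed
    ultimately show "x = 0"
      by (smt (verit) mult.assoc mult_less_cancel_right2 norm_eq_zero norm_ge_zero zero_less_norm_iff)
  qed
  show ?thesis
    unfolding svep_at_def
  proof (intro exI[of _ r] conjI allI impI ballI r)
    fix V f \<mu>
    assume V: "open V \<and> V \<subseteq> ball l r"
      and f: "vector_holomorphic_on f V \<and> (\<forall>\<mu>\<in>V. (T - \<mu> *\<^sub>C id_cblinfun) (f \<mu>) = 0)"
      and \<mu>: "\<mu> \<in> V"
    have zero: "f \<nu> = 0" if "\<nu> \<in> V" "\<nu> \<noteq> l" for \<nu>
      using inj[of \<nu> "f \<nu>"] V f that by blast
    have "continuous (at \<mu> within V) f"
      using f \<mu> unfolding vector_holomorphic_on_def by (blast intro: has_derivative_continuous)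
    then have lim: "(f \<longlongrightarrow> f \<mu>) (at \<mu>)"
      using at_within_open[of \<mu> V] V \<mu> by (simp add: continuous_within)
    have "eventually (\<lambda>\<nu>. \<nu> \<in> V) (at \<mu>)"
      using V \<mu> eventually_at_in_open'[of V \<mu>] by blast
    moreover have "eventually (\<lambda>\<nu>. \<nu> \<noteq> l) (at \<mu>)"
      by (rule eventually_neq_at_within)
    ultimately have "eventually (\<lambda>\<nu>. f \<nu> = 0) (at \<mu>)"
      by eventually_elim (rule zero)
    then have "(f \<longlongrightarrow> 0) (at \<mu>)" by (rule tendsto_eventually)
    then show "f \<mu> = 0" by (rule tendsto_unique[OF trivial_limit_at lim])
  qed
qed

text \<open>The local solution is \<open>f \<mu> = R ^ k (G \<mu> y)\<close> with \<open>G \<mu> = (1 - (\<mu> - l) U)\<^sup>-\<^sup>1\<close>: indeed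
  \<open>(R - (\<mu> - l)) R ^ k = R ^ (k + 1) (1 - (\<mu> - l) U)\<close>, so \<open>(T - \<mu>) (f \<mu>) = R ^ (k + 1) y = 0\<close>,
  while \<open>f l = R ^ k y\<close>.\<close>

lemma svep_at_imp_kernel_stable:
  fixes T U :: "'a::cbanach \<Rightarrow>\<^sub>C\<^sub>L 'a" and l :: complex
  defines "R \<equiv> T - l *\<^sub>C id_cblinfun"
  assumes svep: "svep_at T l"
    and U: "\<And>x. (R \<up> k) x = (R \<up> (k + 1)) (U x)"
    and y: "(R \<up> (k + 1)) y = 0"
  shows "(R \<up> k) y = 0"
proof -
  \<comment> \<open>On this ball \<open>(\<mu> - l) U\<close> is a contraction with factor \<open>1/2\<close>, so \<open>G\<close> exists by Banach's fixed
    point theorem and has norm at most \<open>2\<close>.\<close>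
  define \<rho> where "\<rho> = inverse (2 * (norm U + 1))"
  have \<rho>: "\<rho> > 0" by (simp add: \<rho>_def add_nonneg_pos)
  have contr: "norm ((\<mu> - l) *\<^sub>C U x) \<le> norm x / 2" if "\<mu> \<in> ball l \<rho>" for \<mu> x
  proof -
    have "norm ((\<mu> - l) *\<^sub>C U x) \<le> \<rho> * ((norm U + 1) * norm x)"
      unfolding norm_scaleC
    proof (intro mult_mono)
      show "cmod (\<mu> - l) \<le> \<rho>" using that by (simp add: dist_norm norm_minus_commute)
      show "norm (U x) \<le> (norm U + 1) * norm x"
        using norm_cblinfun[of U x] by (simp add: distrib_right add_increasing2)
    qed (use \<rho> in auto)
    also have "\<rho> * ((norm U + 1) * norm x) = norm x / 2"
    proof -
      have "norm U + 1 \<noteq> 0" using norm_ge_zero[of U] by linarith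
      then show ?thesis by (simp add: \<rho>_def field_simps)
    qed
    finally show ?thesis .
  qed
  have "\<exists>x. x = w + (\<mu> - l) *\<^sub>C U x" if "\<mu> \<in> ball l \<rho>" for \<mu> w
  proof -
    have "\<exists>!x. w + (\<mu> - l) *\<^sub>C U x = x"
    proof (rule banach_fix_type[where c = "1/2"], simp, simp, intro allI)
      fix x z
      have "w + (\<mu> - l) *\<^sub>C U x - (w + (\<mu> - l) *\<^sub>C U z) = (\<mu> - l) *\<^sub>C U (x - z)"
        by (simp add: scaleC_diff_right cblinfun_diff)
      then show "dist (w + (\<mu> - l) *\<^sub>C U x) (w + (\<mu> - l) *\<^sub>C U z) \<le> 1/2 * dist x z"
        using contr[OF that, of "x - z"] by (simp add: dist_norm)
    qed
    then show ?thesis by metis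
  qed
  then obtain G where G: "G \<mu> w = w + (\<mu> - l) *\<^sub>C U (G \<mu> w)" if "\<mu> \<in> ball l \<rho>" for \<mu> w
    by metis
  have uniq: "x = G \<mu> w" if "\<mu> \<in> ball l \<rho>" "x = w + (\<mu> - l) *\<^sub>C U x" for \<mu> w x
  proof -
    have "x - G \<mu> w = (\<mu> - l) *\<^sub>C U (x - G \<mu> w)"
      using arg_cong2[OF that(2) G[OF that(1), of w], of minus]
      unfolding scaleC_diff_right cblinfun_diff add_diff_cancel_left .
    then have "norm (x - G \<mu> w) \<le> norm (x - G \<mu> w) / 2"
      using contr[OF that(1), of "x - G \<mu> w"] by metis
    then show ?thesis by simp
  qed
  have G_norm: "norm (G \<mu> w) \<le> 2 * norm w" if "\<mu> \<in> ball l \<rho>" for \<mu> w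
  proof -
    have "norm (G \<mu> w) \<le> norm w + norm ((\<mu> - l) *\<^sub>C U (G \<mu> w))"
      using norm_triangle_ineq[of w "(\<mu> - l) *\<^sub>C U (G \<mu> w)"] G[OF that, of w] by metis
    then show ?thesis using contr[OF that, of "G \<mu> w"] by linarith
  qed
  have resolvent: "G \<mu> w - G \<nu> w = (\<mu> - \<nu>) *\<^sub>C G \<mu> (U (G \<nu> w))"
    if \<mu>: "\<mu> \<in> ball l \<rho>" and \<nu>: "\<nu> \<in> ball l \<rho>" for \<mu> \<nu> w
  proof -
    define g h x where "g = G \<nu> w" and "h = G \<mu> (U g)" and "x = g + (\<mu> - \<nu>) *\<^sub>C h"
    have g: "g = w + (\<nu> - l) *\<^sub>C U g" and h: "h = U g + (\<mu> - l) *\<^sub>C U h"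
      unfolding g_def h_def by (rule G[OF \<nu>] G[OF \<mu>])+
    have "w + (\<mu> - l) *\<^sub>C U x = w + (\<mu> - l) *\<^sub>C U g + (\<mu> - \<nu>) *\<^sub>C (\<mu> - l) *\<^sub>C U h"
      by (simp add: x_def scaleC_add_right cblinfun_apply_scaleC scaleC_scaleC mult.commute)
    also have "(\<mu> - l) *\<^sub>C U g = (\<nu> - l) *\<^sub>C U g + (\<mu> - \<nu>) *\<^sub>C U g"
      by (simp flip: scaleC_add_left)
    also have "w + ((\<nu> - l) *\<^sub>C U g + (\<mu> - \<nu>) *\<^sub>C U g) + (\<mu> - \<nu>) *\<^sub>C (\<mu> - l) *\<^sub>C U h
        = (w + (\<nu> - l) *\<^sub>C U g) + (\<mu> - \<nu>) *\<^sub>C (U g + (\<mu> - l) *\<^sub>C U h)"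
      by (simp add: scaleC_add_right)
    also have "\<dots> = x" by (simp only: g[symmetric] h[symmetric] x_def)
    finally have "x = G \<mu> w" by (intro uniq[OF \<mu>]) (rule sym)
    then show ?thesis by (simp add: x_def g_def h_def diff_eq_eq add.commute)
  qed
  \<comment> \<open>Using the resolvent identity twice leaves a remainder quadratic in \<open>\<nu> - \<mu>\<close>.\<close>
  have deriv: "((\<lambda>\<mu>. G \<mu> y) has_derivative (\<lambda>h. h *\<^sub>C G \<mu> (U (G \<mu> y)))) (at \<mu>)"
    if \<mu>: "\<mu> \<in> ball l \<rho>" for \<mu>
  proof -
    define w where "w = U (G \<mu> y)"
    have quad: "norm (G \<nu> y - G \<mu> y - (\<nu> - \<mu>) *\<^sub>C G \<mu> w) \<le> K * (norm (\<nu> - \<mu>))\<^sup>2"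
      if \<nu>: "\<nu> \<in> ball l \<rho>" and K: "K = 2 * norm U * (2 * norm w)" for \<nu> K
    proof -
      have "G \<nu> y - G \<mu> y - (\<nu> - \<mu>) *\<^sub>C G \<mu> w = (\<nu> - \<mu>) *\<^sub>C (\<nu> - \<mu>) *\<^sub>C G \<nu> (U (G \<mu> w))"
        by (simp add: resolvent[OF \<nu> \<mu>] w_def flip: scaleC_diff_right)
      then have "norm (G \<nu> y - G \<mu> y - (\<nu> - \<mu>) *\<^sub>C G \<mu> w)
          = (norm (\<nu> - \<mu>))\<^sup>2 * norm (G \<nu> (U (G \<mu> w)))"
        by (simp add: norm_scaleC power2_eq_square)
      also have "\<dots> \<le> (norm (\<nu> - \<mu>))\<^sup>2 * (2 * (norm U * (2 * norm w)))"
        using G_norm[OF \<nu>, of "U (G \<mu> w)"] norm_cblinfun[of U "G \<mu> w"]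
          mult_left_mono[OF G_norm[OF \<mu>, of w], of "norm U"]
        by (intro mult_left_mono) simp_all
      finally show ?thesis by (simp add: K mult_ac)
    qed
    define K where "K = 2 * norm U * (2 * norm w)"
    show ?thesis
      unfolding w_def[symmetric]
    proof (rule has_derivativeI_sandwich[where e = "\<rho> - dist l \<mu>" and H = "\<lambda>\<nu>. K * norm (\<nu> - \<mu>)"])
      show "0 < \<rho> - dist l \<mu>" using \<mu> by simp
      show "bounded_linear (\<lambda>h. h *\<^sub>C G \<mu> w)"
        by (rule bounded_linear_intro[where K = "norm (G \<mu> w)"])
          (simp_all add: scaleC_add_left scaleR_scaleC scaleC_scaleC scaleC_complex_def norm_scaleC)
      show "((\<lambda>\<nu>. K * norm (\<nu> - \<mu>)) \<longlongrightarrow> 0) (at \<mu>)"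
        by (auto intro!: tendsto_eq_intros)
      fix \<nu> assume \<nu>: "\<nu> \<noteq> \<mu>" "dist \<nu> \<mu> < \<rho> - dist l \<mu>"
      then have "\<nu> \<in> ball l \<rho>"
        using dist_triangle[of l \<nu> \<mu>] by (simp add: dist_commute)
      then show "norm (G \<nu> y - G \<mu> y - (\<nu> - \<mu>) *\<^sub>C G \<mu> w) / norm (\<nu> - \<mu>) \<le> K * norm (\<nu> - \<mu>)"
        using quad[of \<nu> K] \<nu>(1) by (simp add: K_def power2_eq_square divide_le_eq mult.assoc)
    qed
  qed
  define f where "f \<mu> = (R \<up> k) (G \<mu> y)" for \<mu>
  have hol: "vector_holomorphic_on f V" if "V \<subseteq> ball l \<rho>" for V
    unfolding vector_holomorphic_on_def
  proof
    fix \<mu> assume "\<mu> \<in> V"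
    then have "((\<lambda>\<mu>. (R \<up> k) (G \<mu> y)) has_derivative (\<lambda>h. (R \<up> k) (h *\<^sub>C G \<mu> (U (G \<mu> y))))) (at \<mu>)"
      using that by (intro bounded_linear.has_derivative[OF bounded_linear_cblinfun] deriv) auto
    then have "(f has_derivative (\<lambda>h. h *\<^sub>C (R \<up> k) (G \<mu> (U (G \<mu> y))))) (at \<mu> within V)"
      unfolding f_def[abs_def] by (simp add: cblinfun_apply_scaleC has_derivative_at_withinI)
    then show "\<exists>f'. (f has_derivative (\<lambda>h. h *\<^sub>C f')) (at \<mu> within V)" by blast
  qed
  have sol: "(T - \<mu> *\<^sub>C id_cblinfun) (f \<mu>) = 0" if "\<mu> \<in> ball l \<rho>" for \<mu>
  proof -
    have "(T - \<mu> *\<^sub>C id_cblinfun) z = R z - (\<mu> - l) *\<^sub>C z" for z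
      using scaleC_add_left[of "\<mu> - l" l z] by (simp add: R_def)
    then have "(T - \<mu> *\<^sub>C id_cblinfun) (f \<mu>)
        = (R \<up> (k + 1)) (G \<mu> y) - (\<mu> - l) *\<^sub>C (R \<up> (k + 1)) (U (G \<mu> y))"
      using U[of "G \<mu> y"] by (simp add: f_def)
    also have "\<dots> = (R \<up> (k + 1)) (G \<mu> y - (\<mu> - l) *\<^sub>C U (G \<mu> y))"
      by (simp only: cblinfun_diff cblinfun_apply_scaleC)
    also have "G \<mu> y - (\<mu> - l) *\<^sub>C U (G \<mu> y) = y"
      using G[OF that, of y] by (metis add_diff_cancel_right')
    finally show ?thesis using y by simp
  qed
  obtain r where r0: "r > 0" and r: "\<forall>V. open V \<and> V \<subseteq> ball l r \<longrightarrow>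
      (\<forall>f. vector_holomorphic_on f V \<and> (\<forall>\<mu>\<in>V. (T - \<mu> *\<^sub>C id_cblinfun) (f \<mu>) = 0)
        \<longrightarrow> (\<forall>\<mu>\<in>V. f \<mu> = 0))"
    using svep unfolding svep_at_def by (elim exE conjE) (rule that)
  let ?V = "ball l (min r \<rho>)"
  have V: "open ?V \<and> ?V \<subseteq> ball l r" by auto
  have "vector_holomorphic_on f ?V \<and> (\<forall>\<mu>\<in>?V. (T - \<mu> *\<^sub>C id_cblinfun) (f \<mu>) = 0)"
    using sol by (auto intro!: hol)
  with r[THEN spec, THEN mp, OF V, THEN spec, THEN mp] have "\<forall>\<mu>\<in>?V. f \<mu> = 0" .
  then have "f l = 0" using r0 \<rho> by simp
  moreover have "G l y = y" using G[of l y] \<rho> by (simp add: scaleC_zero_left)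
  ultimately show ?thesis by (simp add: f_def)
qed


section \<open>Upper triangular operators\<close>

text \<open>Let \<open>n\<close> bound both indices, with Drazin inverses \<open>a\<close> and \<open>b\<close>. The power \<open>M ^ (2 n)\<close> satisfies
  both conditions of \<open>drazin_invertibleI\<close>: the first \<open>n\<close> factors handle the coordinate of \<open>B\<close>, and
  what remains lies in the first coordinate, where the other \<open>n\<close> factors act as \<open>A ^ n\<close>.\<close>

lemma drazin_invertible_upper_triangular:
  fixes A :: "'a::complex_normed_vector \<Rightarrow>\<^sub>C\<^sub>L 'a" and B :: "'b::complex_normed_vector \<Rightarrow>\<^sub>C\<^sub>L 'b"
  assumes "drazin_invertible A" "drazin_invertible B"
  shows "drazin_invertible (upper_triangular_operator A C B)"
proof -
  let ?M = "upper_triangular_operator A C B"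
  obtain a m b m' where a0: "drazin_inverse A a m" and b0: "drazin_inverse B b m'"
    using assms unfolding drazin_invertible_iff by blast
  define n where "n = max m m'"
  have a: "drazin_inverse A a n" and b: "drazin_inverse B b n"
    by (rule drazin_inverse_mono[OF a0] drazin_inverse_mono[OF b0]; simp add: n_def)+
  have Aa: "(A \<up> (2 * n + 1)) ((a \<up> (n + 1)) x) = (A \<up> n) x" for x
    using power_right_factor[OF drazin_inverse_power[OF a, symmetric], of "n + 1" x]
    by (simp only: mult_2 add.assoc)
  have Bb: "(B \<up> (2 * n + 1)) ((b \<up> (n + 1)) x) = (B \<up> n) x" for x
    using power_right_factor[OF drazin_inverse_power[OF b, symmetric], of "n + 1" x]
    by (simp only: mult_2 add.assoc)
  have kerA: "(A \<up> n) x = 0" if "(A \<up> (n + j)) x = 0" for x j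
    by (rule power_kernel_stable[OF drazin_inverse_kernel_stable[OF a] that])
  have kerB: "(B \<up> n) x = 0" if "(B \<up> (n + j)) x = 0" for x j
    by (rule power_kernel_stable[OF drazin_inverse_kernel_stable[OF b] that])
  \<comment> \<open>\<open>M ^ (2 n + 1) v p\<close> has the same second coordinate as \<open>M ^ n p\<close>; the difference \<open>rest p\<close> in the
    first coordinate is then divided by \<open>A ^ (n + 1)\<close> with the help of \<open>a\<close>.\<close>
  define v where "v p = (0 :: 'a, (b \<up> (n + 1)) (snd p))" for p :: "'a \<times> 'b"
  define rest where "rest p = fst ((?M \<up> n) p - (?M \<up> (2 * n + 1)) (v p))" for p
  define u where "u p = (?M \<up> n) (v p) + ((a \<up> (n + 1)) (rest p), 0)" for p
  have v: "bounded_clinear v"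
    unfolding v_def[abs_def] by (intro bounded_clinear_intros)
  have rest: "bounded_clinear rest"
    unfolding rest_def[abs_def] by (intro bounded_clinear_intros v)
  have u: "bounded_clinear u"
    unfolding u_def[abs_def] by (intro bounded_clinear_intros v rest)
  have rest_eq: "(?M \<up> (2 * n + 1)) (v p) = (?M \<up> n) p - (rest p, 0)" for p
  proof -
    have "snd ((?M \<up> n) p - (?M \<up> (2 * n + 1)) (v p)) = 0"
      by (simp only: snd_diff upper_triangular_power_snd v_def snd_conv Bb diff_self)
    then show ?thesis by (simp add: rest_def prod_eq_iff)
  qed
  have add_n: "(T \<up> i) ((T \<up> j) x) = (T \<up> (i + j)) x" for T :: "'c::complex_normed_vector \<Rightarrow>\<^sub>C\<^sub>L 'c" and i j x
    by (simp only: cblinfun_power_add)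
  show ?thesis
  proof (rule drazin_invertibleI[where k = "2 * n" and U = "CBlinfun u"])
    fix p
    have "(?M \<up> (2 * n + 1)) (u p)
        = (?M \<up> n) ((?M \<up> (2 * n + 1)) (v p)) + ((A \<up> (2 * n + 1)) ((a \<up> (n + 1)) (rest p)), 0)"
      by (simp only: u_def cblinfun_add upper_triangular_power_fst add_n add.commute)
    also have "\<dots> = (?M \<up> n) ((?M \<up> n) p)"
      by (simp only: rest_eq Aa cblinfun_diff upper_triangular_power_fst) simp
    finally show "(?M \<up> (2 * n)) p = (?M \<up> (2 * n + 1)) (CBlinfun u p)"
      by (simp only: CBlinfun_apply[OF u] add_n mult_2)
  next
    fix p assume p: "(?M \<up> (2 * n + 1)) p = 0"
    have "(B \<up> (n + (n + 1))) (snd p) = 0"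
      using arg_cong[OF p, of snd]
      by (simp only: upper_triangular_power_snd snd_zero mult_2 add.assoc)
    then have "snd ((?M \<up> n) p) = 0"
      unfolding upper_triangular_power_snd by (rule kerB)
    then obtain x where x: "(?M \<up> n) p = (x, 0)" by (metis prod.collapse)
    have "(?M \<up> (n + 1)) ((?M \<up> n) p) = 0"
      using p by (simp only: add_n mult_2 ac_simps flip: mult_2)
    then have "(A \<up> (n + 1)) x = 0"
      unfolding x upper_triangular_power_fst by (simp add: zero_prod_def)
    then have "(A \<up> n) x = 0" by (rule kerA)
    then have "(?M \<up> n) ((?M \<up> n) p) = 0"
      by (simp only: x upper_triangular_power_fst zero_prod_def)
    then show "(?M \<up> (2 * n)) p = 0" by (simp only: add_n mult_2)
  qed
qed

lemma drazin_invertible_diagonal: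
  assumes D: "drazin_inverse (upper_triangular_operator A C B) D k"
    and zero: "\<And>x. snd (D (x, 0)) = 0"
  shows "drazin_invertible A" "drazin_invertible B"
proof -
  let ?M = "upper_triangular_operator A C B"
  define a where "a = CBlinfun (\<lambda>x. fst (D (x, 0)))"
  define b where "b = CBlinfun (\<lambda>y. snd (D (0, y)))"
  have a: "D (x, 0) = (a x, 0)" for x
    unfolding a_def using zero[of x]
    by (subst CBlinfun_apply) (auto intro!: bounded_clinear_intros simp: prod_eq_iff)
  have b: "snd (D (x, y)) = b y" for x y
  proof -
    have "D (x, y) = D (x, 0) + D (0, y)" by (simp flip: cblinfun_add)
    then show ?thesis
      unfolding b_def using zero[of x] by (subst CBlinfun_apply) (auto intro!: bounded_clinear_intros)
  qed
  have b': "snd (D p) = b (snd p)" for p using b[of "fst p" "snd p"] by simp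
  have M_fst: "?M (x, 0) = (A x, 0)" for x by simp
  have M_snd: "snd (?M p) = B (snd p)" for p by simp
  have comm: "?M (D p) = D (?M p)" and idem: "D (?M (D p)) = D p"
    and pow: "(?M \<up> (k + 1)) (D p) = (?M \<up> k) p" for p
    using D unfolding drazin_inverse_def by blast+
  have "drazin_inverse A a k"
    unfolding drazin_inverse_def
    using comm[of "(_, 0)"] idem[of "(_, 0)"] pow[of "(_, 0)"]
    by (simp only: a M_fst upper_triangular_power_fst prod.inject) blast
  then show "drazin_invertible A" unfolding drazin_invertible_iff by blast
  have "drazin_inverse B b k"
    unfolding drazin_inverse_def
    using arg_cong[OF comm[of "(0, _)"], of snd] arg_cong[OF idem[of "(0, _)"], of snd]
      arg_cong[OF pow[of "(0, _)"], of snd]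
    by (simp only: b' M_snd upper_triangular_power_snd snd_conv) blast
  then show "drazin_invertible B" unfolding drazin_invertible_iff by blast
qed

text \<open>The corner \<open>D21\<close> equals \<open>B ^ k w\<close> and is annihilated by \<open>B ^ (k + 1)\<close>, so kernel stability of \<open>B\<close>
  kills it.\<close>

lemma drazin_inverse_corner_zero_if_kernel_stable:
  fixes D :: "('a::complex_normed_vector \<times> 'b::complex_normed_vector) \<Rightarrow>\<^sub>C\<^sub>L ('a \<times> 'b)"
  assumes D: "drazin_inverse (upper_triangular_operator A C B) D k"
    and ker: "\<And>y. (B \<up> (k + 1)) y = 0 \<Longrightarrow> (B \<up> k) y = 0"
  shows "snd (D (x, 0)) = 0"
proof -
  let ?M = "upper_triangular_operator A C B"
  define w where "w = snd ((D \<up> (k + 1)) (x, 0))"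
  have w: "snd (D (x, 0)) = (B \<up> k) w"
    by (subst drazin_inverse_factor_left[OF D, of _ k]) (simp only: upper_triangular_power_snd w_def)
  have "(B \<up> (k + 1)) (snd (D (x, 0))) = snd ((?M \<up> k) (x, 0))"
    using arg_cong[OF drazin_inverse_power[OF D, of "(x, 0)"], of snd]
    by (simp only: upper_triangular_power_snd)
  also have "\<dots> = 0" by (simp add: upper_triangular_power_fst)
  finally have "(B \<up> (k + (k + 1))) w = 0"
    unfolding w cblinfun_power_add[symmetric] by (simp only: ac_simps)
  with power_kernel_stable[of B k "k + 1" w] ker show ?thesis by (simp add: w)
qed

text \<open>The mirror image: \<open>\<phi> \<circ> D21 = \<psi> \<circ> A ^ k\<close> vanishes on the range of \<open>A ^ (k + 1)\<close>, so \<open>\<psi>\<close> is in the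
  kernel of a high power of the dual of \<open>A\<close>, and hence of its \<open>k\<close>-th power.\<close>

lemma drazin_inverse_corner_zero_if_dual_kernel_stable:
  fixes D :: "('a::complex_normed_vector \<times> 'b::complex_normed_vector) \<Rightarrow>\<^sub>C\<^sub>L ('a \<times> 'b)"
  assumes D: "drazin_inverse (upper_triangular_operator A C B) D k"
    and ker: "\<And>\<psi>. (dual_operator A \<up> (k + 1)) \<psi> = 0 \<Longrightarrow> (dual_operator A \<up> k) \<psi> = 0"
  shows "snd (D (x, 0)) = 0"
proof (rule cdual_separates_points)
  fix \<phi> :: "'b cdual"
  let ?M = "upper_triangular_operator A C B"
  define \<psi> where "\<psi> = CBlinfun (\<lambda>x. \<phi> (snd ((D \<up> (k + 1)) (x, 0))))"
  have \<psi>: "\<psi> x = \<phi> (snd ((D \<up> (k + 1)) (x, 0)))" for x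
    unfolding \<psi>_def by (subst CBlinfun_apply) (auto intro!: bounded_clinear_intros)
  have \<psi>A: "\<psi> ((A \<up> k) x) = \<phi> (snd (D (x, 0)))" for x
    by (subst drazin_inverse_factor_right[OF D, of _ k]) (simp only: upper_triangular_power_fst \<psi>)
  have "\<psi> ((A \<up> (k + (k + 1))) x) = 0" for x
  proof -
    have "D ((A \<up> (k + 1)) x, 0) = (?M \<up> k) (x, 0)"
      using drazin_inverse_power[OF D, of "(x, 0)"]
        drazin_inverse_commute_power[OF D, of "k + 1" "(x, 0)"]
      by (simp only: upper_triangular_power_fst)
    then show ?thesis
      by (simp only: cblinfun_power_add[of A k "k + 1"] \<psi>A upper_triangular_power_fst) simp
  qed
  then have "(dual_operator A \<up> (k + (k + 1))) \<psi> = 0"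
    unfolding dual_operator_power by (intro cblinfun_eqI) (simp del: cblinfun_power.simps)
  then have "(dual_operator A \<up> k) \<psi> = 0"
    using power_kernel_stable[of "dual_operator A" k "k + 1" \<psi>] ker by blast
  then have "\<psi> ((A \<up> k) x) = 0"
    unfolding dual_operator_power by (metis cblinfun_compose_apply zero_cblinfun_apply)
  then show "\<phi> (snd (D (x, 0))) = 0" by (simp only: \<psi>A)
qed

text \<open>The diagonal entries \<open>a = D11\<close> and \<open>b = D22\<close> of a Drazin inverse of \<open>M\<close> provide the factorisations
  \<open>A ^ k = a A ^ (k + 1)\<close> and \<open>B ^ k = B ^ (k + 1) b\<close>. The latter, or the dual of the former, is what
  the SVEP turns into kernel stability.\<close>

lemma drazin_invertible_diagonal_if_svep:
  fixes A :: "'a::cbanach \<Rightarrow>\<^sub>C\<^sub>L 'a" and B :: "'b::cbanach \<Rightarrow>\<^sub>C\<^sub>L 'b"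
  assumes M: "drazin_invertible (upper_triangular_operator A C B - l *\<^sub>C id_cblinfun)"
    and svep: "svep_at (dual_operator A) l \<or> svep_at B l"
  shows "drazin_invertible (A - l *\<^sub>C id_cblinfun)" "drazin_invertible (B - l *\<^sub>C id_cblinfun)"
proof -
  define A' where "A' = A - l *\<^sub>C id_cblinfun"
  define B' where "B' = B - l *\<^sub>C id_cblinfun"
  let ?M = "upper_triangular_operator A' C B'"
  obtain D k where D: "drazin_inverse ?M D k"
    using M unfolding drazin_invertible_iff A'_def B'_def upper_triangular_operator_shift by blast
  note pow = drazin_inverse_power[OF D]
  have zero: "snd (D (x, 0)) = 0" for x
    using svep
  proof
    assume svepA: "svep_at (dual_operator A) l"
    define a where "a = CBlinfun (\<lambda>x. fst (D (x, 0)))"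
    have a: "a x = fst (D (x, 0))" for x
      unfolding a_def by (subst CBlinfun_apply) (auto intro!: bounded_clinear_intros)
    have aA: "a ((A' \<up> (k + 1)) x) = (A' \<up> k) x" for x
    proof -
      have "D ((A' \<up> (k + 1)) x, 0) = ((A' \<up> k) x, 0)"
        using pow[of "(x, 0)"] drazin_inverse_commute_power[OF D, of "k + 1" "(x, 0)"]
        by (simp only: upper_triangular_power_fst)
      then show ?thesis by (simp only: a fst_conv)
    qed
    have "(dual_operator A' \<up> k) \<phi> = (dual_operator A' \<up> (k + 1)) (dual_operator a \<phi>)" for \<phi>
      unfolding dual_operator_power
      by (rule cblinfun_eqI) (simp only: cblinfun_compose_apply dual_operator_apply aA)
    then have "(dual_operator A' \<up> k) \<psi> = 0" if "(dual_operator A' \<up> (k + 1)) \<psi> = 0" for \<psi>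
      using svep_at_imp_kernel_stable[OF svepA, of k "dual_operator a" \<psi>] that
      unfolding A'_def dual_operator_shift by blast
    then show ?thesis by (rule drazin_inverse_corner_zero_if_dual_kernel_stable[OF D])
  next
    assume svepB: "svep_at B l"
    define b where "b = CBlinfun (\<lambda>y. snd (D (0, y)))"
    have b: "b y = snd (D (0, y))" for y
      unfolding b_def by (subst CBlinfun_apply) (auto intro!: bounded_clinear_intros)
    have "(B' \<up> k) y = (B' \<up> (k + 1)) (b y)" for y
      using arg_cong[OF pow[of "(0, y)"], of snd]
      by (simp only: upper_triangular_power_snd b snd_conv)
    then have "(B' \<up> k) y = 0" if "(B' \<up> (k + 1)) y = 0" for y
      using svep_at_imp_kernel_stable[OF svepB, of k b y] that unfolding B'_def by blast
    then show ?thesis by (rule drazin_inverse_corner_zero_if_kernel_stable[OF D])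
  qed
  show "drazin_invertible (A - l *\<^sub>C id_cblinfun)" "drazin_invertible (B - l *\<^sub>C id_cblinfun)"
    using drazin_invertible_diagonal[OF D zero] by (simp_all only: A'_def B'_def)
qed

theorem theorem3p1:
  fixes A :: "'x::cbanach \<Rightarrow>\<^sub>C\<^sub>L 'x"
    and B :: "'y::cbanach \<Rightarrow>\<^sub>C\<^sub>L 'y"
    and C :: "'y \<Rightarrow>\<^sub>C\<^sub>L 'x"
  assumes "cinfinite_dimensional TYPE('x)"
    and "cinfinite_dimensional TYPE('y)"
  shows "drazin_spectrum (upper_triangular_operator A C B)
           \<union> (svep_failure_set (dual_operator A) \<inter> svep_failure_set B)
         = drazin_spectrum A \<union> drazin_spectrum B"
proof (rule set_eqI)
  fix l
  have "drazin_invertible (upper_triangular_operator A C B - l *\<^sub>C id_cblinfun)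
      \<and> (svep_at (dual_operator A) l \<or> svep_at B l)
      \<longleftrightarrow> drazin_invertible (A - l *\<^sub>C id_cblinfun) \<and> drazin_invertible (B - l *\<^sub>C id_cblinfun)"
    using drazin_invertible_diagonal_if_svep[of A C B l] drazin_invertible_imp_svep_at[of B l]
      drazin_invertible_upper_triangular[of "A - l *\<^sub>C id_cblinfun" "B - l *\<^sub>C id_cblinfun" C]
    unfolding upper_triangular_operator_shift by blast
  then show "l \<in> drazin_spectrum (upper_triangular_operator A C B)
           \<union> (svep_failure_set (dual_operator A) \<inter> svep_failure_set B)
      \<longleftrightarrow> l \<in> drazin_spectrum A \<union> drazin_spectrum B"
    unfolding drazin_spectrum_def svep_failure_set_def by blast
qed

end
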